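(* Let $X := \mathcal{C}([0,+\infty)) \cap L^1([0,+\infty))$ with the metric $$d_X(f,g) := \|f-g\|_{L^1} + \sum_{n=1}^{\infty} \frac{1}{2^n}\cdot \frac{\|f-g\|_{\infty,n}}{1+\|f-g\|_{\infty,n}},\qquad \|f\|_{\infty,n} = \max\{|f(x)| : x\in[0,n]\},$$ let $\mathcal{A} = \{ f \in X : \limsup_{x \to +\infty} |f(x)| = +\infty \}$, and let $$\mathcal{A}_0 := \{(f_n)_n : f_n \in \mathcal{A} \text{ for all } n\in\mathbb{N} \text{ and } d_X(f_n,0)\to 0 \text{ as } n\to\infty\}.$$ Let $c_0(X) := \{(f_n)_n : f_n\in X \text{ for all } n\in\mathbb{N} \text{ and } d_X(f_n,0)\to 0 \text{ as } n\to\infty\}$, endowed with the metric $d_{c_0(X)}((f_n)_n,(g_n)_n)=\sup_{n\in\mathbb{N}} d_X(f_n,g_n)$. Then $\mathcal{A}_0$ is maximal dense-lineable in $c_0(X)$; that is, there is a vector subspace $M\subset c_0(X)$, dense in $(c_0(X),d_{c_0(X)})$, with $\dim(M)=\dim(c_0(X))$ and $M\setminus\{0\}\subset\mathcal{A}_0$.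
   Context: $\mathcal{C}([0,+\infty))$ is the real vector space of all continuous functions $[0,+\infty)\to\mathbb{R}$, and $L^1([0,+\infty))$ is the space of Lebesgue integrable functions on $[0,+\infty)$ with $\|f\|_{L^1}=\int_0^\infty |f(x)|\,dx$. Vector space operations on sequences are componentwise. Dimension means algebraic (Hamel) dimension over $\mathbb{R}$. A subset $A$ of a topological vector space $Z$ is maximal dense-lineable if there is a dense vector subspace $M$ of $Z$ with $M\setminus\{0\}\subset A$ and $\dim(M)=\dim(Z)$. *)

theory Defs
  imports "HOL-Analysis.Analysis"
begin

section \<open>The metric vector space of continuous integrable functions on the half-line\<close>

definition L1_norm :: "(real \<Rightarrow> real) \<Rightarrow> real"
  where "L1_norm f = (LINT x:{0..}|lebesgue. \<bar>f x\<bar>)"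

definition sup_norm_upto :: "nat \<Rightarrow> (real \<Rightarrow> real) \<Rightarrow> real"
  where "sup_norm_upto n f = (SUP x\<in>{0..real n}. \<bar>f x\<bar>)"

text \<open>The supremum is a maximum for the functions of interest.\<close>

lemma sup_norm_upto_attained:
  assumes "continuous_on {0..} f"
  shows "\<exists>x\<in>{0..real n}. sup_norm_upto n f = \<bar>f x\<bar> \<and> (\<forall>y\<in>{0..real n}. \<bar>f y\<bar> \<le> \<bar>f x\<bar>)"
proof -
  have "continuous_on {0..real n} (\<lambda>x. \<bar>f x\<bar>)"
    by (intro continuous_intros continuous_on_subset[OF assms]) auto
  then obtain x where x: "x \<in> {0..real n}" "\<And>y. y \<in> {0..real n} \<Longrightarrow> \<bar>f y\<bar> \<le> \<bar>f x\<bar>"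
    using continuous_attains_sup[of "{0..real n}" "\<lambda>x. \<bar>f x\<bar>"] by auto
  have "sup_norm_upto n f = \<bar>f x\<bar>"
    unfolding sup_norm_upto_def using x by (intro cSup_eq_maximum) auto
  with x show ?thesis by blast
qed

text \<open>
  The sum over \<open>n \<ge> 1\<close> is shifted to start at \<open>0\<close>. The metric on the function space is
  \<open>d f g = cL1_size (f - g)\<close>.
\<close>

definition cL1_size :: "(real \<Rightarrow> real) \<Rightarrow> real"
  where "cL1_size f = L1_norm f +
    (\<Sum>n. 1 / 2 ^ Suc n * (sup_norm_upto (Suc n) f / (1 + sup_norm_upto (Suc n) f)))"

text \<open>
  A function on the half-line \<open>[0, \<infinity>)\<close> is represented by its extension by zero to the
  negative reals, so that equality in the type is equality on the half-line.
\<close>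

typedef cL1 =
  "{f :: real \<Rightarrow> real. continuous_on {0..} f \<and> set_integrable lebesgue {0..} f \<and> (\<forall>x<0. f x = 0)}"
  morphisms cL1_fun Abs_cL1
  by (rule exI[of _ "\<lambda>_. 0"]) (auto simp: set_integrable_def)

setup_lifting type_definition_cL1

instantiation cL1 :: real_vector
begin

lift_definition zero_cL1 :: cL1 is "\<lambda>_. 0"
  by (auto simp: set_integrable_def)

lift_definition plus_cL1 :: "cL1 \<Rightarrow> cL1 \<Rightarrow> cL1" is "\<lambda>f g x. f x + g x"
  by (auto intro!: continuous_intros)

lift_definition uminus_cL1 :: "cL1 \<Rightarrow> cL1" is "\<lambda>f x. - f x"
  by (auto intro!: continuous_intros simp: set_integrable_def)

lift_definition minus_cL1 :: "cL1 \<Rightarrow> cL1 \<Rightarrow> cL1" is "\<lambda>f g x. f x - g x"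
  by (auto intro!: continuous_intros)

lift_definition scaleR_cL1 :: "real \<Rightarrow> cL1 \<Rightarrow> cL1" is "\<lambda>c f x. c * f x"
  by (auto intro!: continuous_intros)

instance
  by standard (transfer, simp add: algebra_simps fun_eq_iff)+

end

lemma L1_norm_nonneg: "L1_norm f \<ge> 0"
  unfolding L1_norm_def set_lebesgue_integral_def by (intro Bochner_Integration.integral_nonneg) auto

lemma L1_norm_add:
  assumes "set_integrable lebesgue {0..} f" "set_integrable lebesgue {0..} g"
  shows "L1_norm (\<lambda>x. f x + g x) \<le> L1_norm f + L1_norm g"
proof -
  have "L1_norm (\<lambda>x. f x + g x) \<le> (LINT x:{0..}|lebesgue. \<bar>f x\<bar> + \<bar>g x\<bar>)"
    unfolding L1_norm_def using assms
    by (intro set_integral_mono set_integral_add set_integrable_abs) auto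
  also have "\<dots> = L1_norm f + L1_norm g"
    unfolding L1_norm_def using assms by (intro set_integral_add set_integrable_abs)
  finally show ?thesis .
qed

lemma L1_norm_mult: "L1_norm (\<lambda>x. c * f x) = \<bar>c\<bar> * L1_norm f"
  unfolding L1_norm_def by (simp add: abs_mult)

lemma sup_norm_upto_upper:
  assumes "continuous_on {0..} f" "x \<in> {0..real n}"
  shows "\<bar>f x\<bar> \<le> sup_norm_upto n f"
  using sup_norm_upto_attained[OF assms(1), of n] assms(2) by auto

lemma sup_norm_upto_nonneg:
  assumes "continuous_on {0..} f"
  shows "sup_norm_upto n f \<ge> 0"
  using sup_norm_upto_attained[OF assms(1), of n] by auto

lemma sup_norm_upto_add:
  assumes "continuous_on {0..} f" "continuous_on {0..} g"
  shows "sup_norm_upto n (\<lambda>x. f x + g x) \<le> sup_norm_upto n f + sup_norm_upto n g"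
proof -
  have "continuous_on {0..} (\<lambda>x. f x + g x)"
    using assms by (intro continuous_intros)
  then obtain x where x: "x \<in> {0..real n}" "sup_norm_upto n (\<lambda>x. f x + g x) = \<bar>f x + g x\<bar>"
    using sup_norm_upto_attained by blast
  show ?thesis
    using sup_norm_upto_upper[OF assms(1) x(1)] sup_norm_upto_upper[OF assms(2) x(1)] x(2)
    by linarith
qed

lemma sup_norm_upto_mult:
  assumes "continuous_on {0..} f"
  shows "sup_norm_upto n (\<lambda>x. c * f x) \<le> \<bar>c\<bar> * sup_norm_upto n f"
proof -
  have "continuous_on {0..} (\<lambda>x. c * f x)"
    using assms by (intro continuous_intros)
  then obtain x where x: "x \<in> {0..real n}" "sup_norm_upto n (\<lambda>x. c * f x) = \<bar>c * f x\<bar>"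
    using sup_norm_upto_attained by blast
  show ?thesis
    using mult_left_mono[OF sup_norm_upto_upper[OF assms(1) x(1)], of "\<bar>c\<bar>"] x(2)
    by (simp add: abs_mult)
qed

lemma sup_ratio_mono: "0 \<le> s \<Longrightarrow> s \<le> t \<Longrightarrow> s / (1 + s) \<le> t / (1 + t :: real)"
  by (simp add: divide_simps) (simp add: algebra_simps)

lemma sup_ratio_add:
  fixes s t :: real
  assumes "0 \<le> s" "0 \<le> t"
  shows "(s + t) / (1 + (s + t)) \<le> s / (1 + s) + t / (1 + t)"
proof -
  have "s / (1 + (s + t)) \<le> s / (1 + s)" "t / (1 + (s + t)) \<le> t / (1 + t)"
    using assms by (auto intro!: divide_left_mono)
  then show ?thesis by (simp add: add_divide_distrib)
qed

lemma sup_ratio_mult: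
  fixes c t :: real
  assumes "0 \<le> c" "0 \<le> t"
  shows "(c * t) / (1 + c * t) \<le> max 1 c * (t / (1 + t))"
proof (cases "c \<le> 1")
  case True
  then have "c * t \<le> t" using assms by (simp add: mult_left_le_one_le)
  then show ?thesis using True assms sup_ratio_mono[of "c * t" t] by (simp add: max_def)
next
  case False
  then have "1 + t \<le> 1 + c * t" using assms by (simp add: mult_le_cancel_right1)
  then have "(c * t) / (1 + c * t) \<le> (c * t) / (1 + t)"
    using assms by (intro divide_left_mono) (auto intro!: mult_pos_pos add_pos_nonneg)
  then show ?thesis using False by (simp add: max_def)
qed

lemma cL1_size_summable:
  assumes "continuous_on {0..} f"
  shows "summable (\<lambda>n. 1 / 2 ^ Suc n * (sup_norm_upto (Suc n) f / (1 + sup_norm_upto (Suc n) f)))"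
proof (rule summable_comparison_test'[of "\<lambda>n. (1/2)^n" 0])
  show "summable (\<lambda>n. (1/2::real)^n)" by (rule summable_geometric) simp
next
  fix n
  let ?s = "sup_norm_upto (Suc n) f"
  have s: "?s \<ge> 0" by (rule sup_norm_upto_nonneg[OF assms])
  then have r: "0 \<le> ?s / (1 + ?s)" "?s / (1 + ?s) \<le> 1" by (auto simp: divide_simps)
  have "1 / 2 ^ Suc n * (?s / (1 + ?s)) \<le> (1/2)^n * 1"
    using r by (intro mult_mono) (auto simp: power_divide divide_simps)
  then show "norm (1 / 2 ^ Suc n * (?s / (1 + ?s))) \<le> (1/2)^n"
    using abs_of_nonneg[OF mult_nonneg_nonneg[OF _ r(1), of "1 / 2 ^ Suc n"]] by simp
qed

lemma cL1_size_term_nonneg: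
  assumes "continuous_on {0..} f"
  shows "0 \<le> 1 / 2 ^ Suc n * (sup_norm_upto (Suc n) f / (1 + sup_norm_upto (Suc n) f))"
  using sup_norm_upto_nonneg[OF assms, of "Suc n"] by (intro mult_nonneg_nonneg divide_nonneg_nonneg) auto

lemma cL1_size_nonneg:
  assumes "continuous_on {0..} f"
  shows "cL1_size f \<ge> 0"
  unfolding cL1_size_def
  by (intro add_nonneg_nonneg L1_norm_nonneg suminf_nonneg cL1_size_summable cL1_size_term_nonneg assms)

lemma cL1_size_add:
  assumes "continuous_on {0..} f" "continuous_on {0..} g"
    and "set_integrable lebesgue {0..} f" "set_integrable lebesgue {0..} g"
  shows "cL1_size (\<lambda>x. f x + g x) \<le> cL1_size f + cL1_size g"
proof -
  let ?T = "\<lambda>h n. 1 / 2 ^ Suc n * (sup_norm_upto (Suc n) h / (1 + sup_norm_upto (Suc n) h))"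
  have c: "continuous_on {0..} (\<lambda>x. f x + g x)" using assms by (intro continuous_intros)
  have le: "?T (\<lambda>x. f x + g x) n \<le> ?T f n + ?T g n" for n
  proof -
    let ?s = "sup_norm_upto (Suc n)"
    have nn: "0 \<le> ?s f" "0 \<le> ?s g" "0 \<le> ?s (\<lambda>x. f x + g x)"
      using assms c by (auto intro: sup_norm_upto_nonneg)
    have "?s (\<lambda>x. f x + g x) / (1 + ?s (\<lambda>x. f x + g x)) \<le> (?s f + ?s g) / (1 + (?s f + ?s g))"
      by (rule sup_ratio_mono[OF nn(3) sup_norm_upto_add[OF assms(1,2)]])
    also have "\<dots> \<le> ?s f / (1 + ?s f) + ?s g / (1 + ?s g)"
      by (rule sup_ratio_add[OF nn(1,2)])
    finally show ?thesis
      unfolding distrib_left[symmetric] by (rule mult_left_mono) simp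
  qed
  have "suminf (?T (\<lambda>x. f x + g x)) \<le> (\<Sum>n. ?T f n + ?T g n)"
    by (intro suminf_le le summable_add cL1_size_summable assms c)
  also have "\<dots> = suminf (?T f) + suminf (?T g)"
    by (intro suminf_add[symmetric] cL1_size_summable assms)
  finally show ?thesis
    unfolding cL1_size_def using L1_norm_add[OF assms(3,4)] by linarith
qed

lemma cL1_size_mult:
  assumes "continuous_on {0..} f"
  shows "cL1_size (\<lambda>x. c * f x) \<le> max 1 \<bar>c\<bar> * cL1_size f"
proof -
  let ?T = "\<lambda>h n. 1 / 2 ^ Suc n * (sup_norm_upto (Suc n) h / (1 + sup_norm_upto (Suc n) h))"
  have c: "continuous_on {0..} (\<lambda>x. c * f x)" using assms by (intro continuous_intros)
  have le: "?T (\<lambda>x. c * f x) n \<le> max 1 \<bar>c\<bar> * ?T f n" for n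
  proof -
    let ?s = "sup_norm_upto (Suc n)"
    have nn: "0 \<le> ?s f" "0 \<le> ?s (\<lambda>x. c * f x)"
      using assms c by (auto intro: sup_norm_upto_nonneg)
    have "?s (\<lambda>x. c * f x) / (1 + ?s (\<lambda>x. c * f x)) \<le> (\<bar>c\<bar> * ?s f) / (1 + \<bar>c\<bar> * ?s f)"
      by (rule sup_ratio_mono[OF nn(2) sup_norm_upto_mult[OF assms(1)]])
    also have "\<dots> \<le> max 1 \<bar>c\<bar> * (?s f / (1 + ?s f))"
      by (rule sup_ratio_mult[OF _ nn(1)]) simp
    finally have "?T (\<lambda>x. c * f x) n \<le> 1 / 2 ^ Suc n * (max 1 \<bar>c\<bar> * (?s f / (1 + ?s f)))"
      by (rule mult_left_mono) simp
    then show ?thesis by (simp only: mult.left_commute)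
  qed
  have "suminf (?T (\<lambda>x. c * f x)) \<le> (\<Sum>n. max 1 \<bar>c\<bar> * ?T f n)"
    by (intro suminf_le le summable_mult cL1_size_summable assms c)
  also have "\<dots> = max 1 \<bar>c\<bar> * suminf (?T f)"
    by (intro suminf_mult cL1_size_summable assms)
  finally have 1: "suminf (?T (\<lambda>x. c * f x)) \<le> max 1 \<bar>c\<bar> * suminf (?T f)" .
  have 2: "L1_norm (\<lambda>x. c * f x) \<le> max 1 \<bar>c\<bar> * L1_norm f"
    unfolding L1_norm_mult by (intro mult_right_mono L1_norm_nonneg) simp
  show ?thesis unfolding cL1_size_def distrib_left by (rule add_mono[OF 2 1])
qed

lemma cL1_size_uminus: "cL1_size (\<lambda>x. - f x) = cL1_size f"
  by (simp add: cL1_size_def L1_norm_def sup_norm_upto_def)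

lemma cL1_size_zero: "cL1_size (\<lambda>x. 0) = 0"
  by (simp add: cL1_size_def L1_norm_def sup_norm_upto_def)

lemma cL1_size_eq_0:
  assumes "continuous_on {0..} f" "cL1_size f = 0" "x \<ge> 0"
  shows "f x = 0"
proof -
  let ?T = "\<lambda>n. 1 / 2 ^ Suc n * (sup_norm_upto (Suc n) f / (1 + sup_norm_upto (Suc n) f))"
  have "suminf ?T \<ge> 0"
    by (intro suminf_nonneg cL1_size_summable cL1_size_term_nonneg assms)
  then have "suminf ?T = 0"
    using assms(2) L1_norm_nonneg[of f] unfolding cL1_size_def by linarith
  then have z: "?T n = 0" for n
    using suminf_eq_zero_iff[OF cL1_size_summable[OF assms(1)] cL1_size_term_nonneg[OF assms(1)]]
    by blast
  obtain n where n: "x \<le> real n" using real_arch_simple by blast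
  have "sup_norm_upto (Suc n) f = 0"
    using z[of n] sup_norm_upto_nonneg[OF assms(1), of "Suc n"] by auto
  then show ?thesis
    using sup_norm_upto_upper[OF assms(1), of x "Suc n"] n assms(3) by simp
qed

instantiation cL1 :: metric_space
begin

lift_definition dist_cL1 :: "cL1 \<Rightarrow> cL1 \<Rightarrow> real"
  is "\<lambda>f g. cL1_size (\<lambda>x. f x - g x)" .

definition uniformity_cL1 :: "(cL1 \<times> cL1) filter"
  where "uniformity_cL1 = (INF e\<in>{0 <..}. principal {(x, y). dist x y < e})"

definition open_cL1 :: "cL1 set \<Rightarrow> bool"
  where "open_cL1 S = (\<forall>x\<in>S. \<forall>\<^sub>F (x', y) in uniformity. x' = x \<longrightarrow> y \<in> S)"

instance
proof
  fix f g h :: cL1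
  show "dist f g = 0 \<longleftrightarrow> f = g"
  proof
    assume "dist f g = 0"
    then show "f = g"
    proof transfer
      fix f g :: "real \<Rightarrow> real"
      assume f: "continuous_on {0..} f \<and> set_integrable lebesgue {0..} f \<and> (\<forall>x<0. f x = 0)"
        and g: "continuous_on {0..} g \<and> set_integrable lebesgue {0..} g \<and> (\<forall>x<0. g x = 0)"
        and 0: "cL1_size (\<lambda>x. f x - g x) = 0"
      have "continuous_on {0..} (\<lambda>x. f x - g x)"
        using f g by (intro continuous_intros) auto
      from cL1_size_eq_0[OF this 0] have "f x = g x" if "x \<ge> 0" for x
        using that by simp
      with f g show "f = g" by (metis ext not_le)
    qed
  next
    assume "f = g"
    then show "dist f g = 0" by transfer (simp add: cL1_size_zero)
  qed
  show "dist f g \<le> dist f h + dist g h"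
  proof transfer
    fix f g h :: "real \<Rightarrow> real"
    assume f: "continuous_on {0..} f \<and> set_integrable lebesgue {0..} f \<and> (\<forall>x<0. f x = 0)"
      and g: "continuous_on {0..} g \<and> set_integrable lebesgue {0..} g \<and> (\<forall>x<0. g x = 0)"
      and h: "continuous_on {0..} h \<and> set_integrable lebesgue {0..} h \<and> (\<forall>x<0. h x = 0)"
    have "cL1_size (\<lambda>x. (f x - h x) + (h x - g x))
        \<le> cL1_size (\<lambda>x. f x - h x) + cL1_size (\<lambda>x. h x - g x)"
      using f g h by (intro cL1_size_add continuous_intros set_integral_diff) auto
    then show "cL1_size (\<lambda>x. f x - g x) \<le> cL1_size (\<lambda>x. f x - h x) + cL1_size (\<lambda>x. g x - h x)"
      using cL1_size_uminus[of "\<lambda>x. h x - g x"] by simp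
  qed
qed (rule uniformity_cL1_def open_cL1_def)+

end

lemma dist_cL1_add: "dist (f + g) 0 \<le> dist f 0 + dist g (0 :: cL1)"
  by transfer (auto intro!: cL1_size_add)

lemma dist_cL1_scaleR: "dist (c *\<^sub>R f) 0 \<le> max 1 \<bar>c\<bar> * dist f (0 :: cL1)"
  by transfer (simp, intro cL1_size_mult, simp)

definition unbounded_cL1 :: "cL1 set"
  where "unbounded_cL1 = {f. Limsup at_top (\<lambda>x. ereal \<bar>cL1_fun f x\<bar>) = \<infinity>}"


section \<open>Null sequences\<close>

typedef c0_cL1 = "{F :: nat \<Rightarrow> cL1. (\<lambda>n. dist (F n) 0) \<longlonglongrightarrow> 0}"
  morphisms c0_seq Abs_c0_cL1
  by (rule exI[of _ "\<lambda>_. 0"]) simp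

setup_lifting type_definition_c0_cL1

lemma null_add:
  fixes F G :: "nat \<Rightarrow> cL1"
  assumes "(\<lambda>n. dist (F n) 0) \<longlonglongrightarrow> 0" "(\<lambda>n. dist (G n) 0) \<longlonglongrightarrow> 0"
  shows "(\<lambda>n. dist (F n + G n) 0) \<longlonglongrightarrow> 0"
proof (rule Lim_null_comparison)
  show "\<forall>\<^sub>F n in sequentially. norm (dist (F n + G n) 0) \<le> dist (F n) 0 + dist (G n) 0"
    by (simp add: dist_cL1_add)
  show "(\<lambda>n. dist (F n) 0 + dist (G n) 0) \<longlonglongrightarrow> 0"
    using tendsto_add[OF assms] by simp
qed

lemma null_scaleR:
  fixes F :: "nat \<Rightarrow> cL1"
  assumes "(\<lambda>n. dist (F n) 0) \<longlonglongrightarrow> 0"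
  shows "(\<lambda>n. dist (c *\<^sub>R F n) 0) \<longlonglongrightarrow> 0"
proof (rule Lim_null_comparison)
  show "\<forall>\<^sub>F n in sequentially. norm (dist (c *\<^sub>R F n) 0) \<le> max 1 \<bar>c\<bar> * dist (F n) 0"
    by (simp add: dist_cL1_scaleR)
  show "(\<lambda>n. max 1 \<bar>c\<bar> * dist (F n) 0) \<longlonglongrightarrow> 0"
    using tendsto_mult_right_zero[OF assms] .
qed

instantiation c0_cL1 :: real_vector
begin

lift_definition zero_c0_cL1 :: c0_cL1 is "\<lambda>_. 0"
  by simp

lift_definition plus_c0_cL1 :: "c0_cL1 \<Rightarrow> c0_cL1 \<Rightarrow> c0_cL1" is "\<lambda>F G n. F n + G n"
  by (rule null_add)

lift_definition uminus_c0_cL1 :: "c0_cL1 \<Rightarrow> c0_cL1" is "\<lambda>F n. - F n"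
  using null_scaleR[of _ "-1"] by simp

lift_definition minus_c0_cL1 :: "c0_cL1 \<Rightarrow> c0_cL1 \<Rightarrow> c0_cL1" is "\<lambda>F G n. F n - G n"
  using null_add null_scaleR[of _ "-1"] by fastforce

lift_definition scaleR_c0_cL1 :: "real \<Rightarrow> c0_cL1 \<Rightarrow> c0_cL1" is "\<lambda>c F n. c *\<^sub>R F n"
  by (rule null_scaleR)

instance
  by standard (transfer, simp add: algebra_simps fun_eq_iff)+

end

lemma null_seq_bdd_above:
  fixes F G :: "nat \<Rightarrow> cL1"
  assumes "(\<lambda>n. dist (F n) 0) \<longlonglongrightarrow> 0" "(\<lambda>n. dist (G n) 0) \<longlonglongrightarrow> 0"
  shows "bdd_above (range (\<lambda>n. dist (F n) (G n)))"
proof -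
  have "(\<lambda>n. dist (F n) 0 + dist (G n) 0) \<longlonglongrightarrow> 0 + 0"
    by (rule tendsto_add[OF assms])
  then have "Bseq (\<lambda>n. dist (F n) 0 + dist (G n) 0)"
    by (intro convergent_imp_Bseq convergentI)
  then obtain K where K: "\<And>n. norm (dist (F n) 0 + dist (G n) 0) \<le> K"
    by (auto simp: Bseq_def)
  have "dist (F n) (G n) \<le> K" for n
    using dist_triangle2[of "F n" "G n" 0] K[of n] by simp
  then show ?thesis by (intro bdd_aboveI2)
qed

instantiation c0_cL1 :: metric_space
begin

lift_definition dist_c0_cL1 :: "c0_cL1 \<Rightarrow> c0_cL1 \<Rightarrow> real"
  is "\<lambda>F G. (SUP n. dist (F n) (G n))" .

definition uniformity_c0_cL1 :: "(c0_cL1 \<times> c0_cL1) filter"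
  where "uniformity_c0_cL1 = (INF e\<in>{0 <..}. principal {(x, y). dist x y < e})"

definition open_c0_cL1 :: "c0_cL1 set \<Rightarrow> bool"
  where "open_c0_cL1 S = (\<forall>x\<in>S. \<forall>\<^sub>F (x', y) in uniformity. x' = x \<longrightarrow> y \<in> S)"

instance
proof
  fix F G H :: c0_cL1
  show "dist F G = 0 \<longleftrightarrow> F = G"
  proof
    assume "dist F G = 0"
    then show "F = G"
    proof transfer
      fix F G :: "nat \<Rightarrow> cL1"
      assume a: "(\<lambda>n. dist (F n) 0) \<longlonglongrightarrow> 0" "(\<lambda>n. dist (G n) 0) \<longlonglongrightarrow> 0"
        "(SUP n. dist (F n) (G n)) = 0"
      have "dist (F n) (G n) \<le> 0" for n
        using cSUP_upper[OF UNIV_I null_seq_bdd_above[OF a(1,2)], of n] a(3) by simp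
      then show "F = G" by (intro ext) simp
    qed
  next
    assume "F = G"
    then show "dist F G = 0" by transfer simp
  qed
  show "dist F G \<le> dist F H + dist G H"
  proof transfer
    fix F G H :: "nat \<Rightarrow> cL1"
    assume a: "(\<lambda>n. dist (F n) 0) \<longlonglongrightarrow> 0" "(\<lambda>n. dist (G n) 0) \<longlonglongrightarrow> 0"
      "(\<lambda>n. dist (H n) 0) \<longlonglongrightarrow> 0"
    show "(SUP n. dist (F n) (G n)) \<le> (SUP n. dist (F n) (H n)) + (SUP n. dist (G n) (H n))"
    proof (rule cSUP_least)
      fix n
      show "dist (F n) (G n) \<le> (SUP n. dist (F n) (H n)) + (SUP n. dist (G n) (H n))"
        using dist_triangle2[of "F n" "G n" "H n"]
          cSUP_upper[OF UNIV_I null_seq_bdd_above[OF a(1,3)], of n]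
          cSUP_upper[OF UNIV_I null_seq_bdd_above[OF a(2,3)], of n] by linarith
    qed simp
  qed
qed (rule uniformity_c0_cL1_def open_c0_cL1_def)+

end

definition null_seqs_unbounded :: "c0_cL1 set"
  where "null_seqs_unbounded =
    {F. (\<forall>n. c0_seq F n \<in> unbounded_cL1) \<and> (\<lambda>n. dist (c0_seq F n) 0) \<longlonglongrightarrow> 0}"


section \<open>Maximal dense-lineability\<close>

text \<open>
  The library's \<^const>\<open>dim\<close> is a natural number, which is \<open>0\<close> on infinite-dimensional spaces;
  equality of Hamel dimensions is therefore expressed by equipollence of bases.
\<close>

definition same_hamel_dim :: "'a::real_vector set \<Rightarrow> 'b::real_vector set \<Rightarrow> bool"
  where "same_hamel_dim U V \<longleftrightarrow>
    (\<exists>B C. independent B \<and> span B = U \<and> independent C \<and> span C = V \<and> B \<approx> C)"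

definition maximal_dense_lineable :: "'a::{real_vector, topological_space} set \<Rightarrow> bool"
  where "maximal_dense_lineable A \<longleftrightarrow>
    (\<exists>M. subspace M \<and> closure M = UNIV \<and> M - {0} \<subseteq> A \<and> same_hamel_dim M (UNIV :: 'a set))"

end

theory Submission
  imports Defs
begin

text \<open>
  The construction perturbs a dense family of tame sequences by small wild ones.

  Call a function vanishing near infinity tame. Cutting off a function of the space far out
  changes it little, so the null sequences with tame components are dense
  (\<open>eventually_vanishing_sequences_dense\<close>). Adding a tame function does not
  affect unboundedness at infinity. Hence, if sequences \<open>w\<^sub>i\<close> are such that every
  nontrivial linear combination is unbounded in every component, then so is every nontrivial
  linear combination of the sums \<open>d\<^sub>i + w\<^sub>i\<close>, whatever tame sequences
  \<open>d\<^sub>i\<close> are chosen. Since zero is bounded, this one property gives at once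
  that the vectors \<open>d\<^sub>i + w\<^sub>i\<close> are distinct and linearly independent and
  that every nonzero element of their span \<open>M\<close> is unbounded in every component
  (\<open>nontrivial_combinations_span\<close>).

  The index \<open>i\<close> ranges over all pairs \<open>(F, k)\<close> of a null sequence and a natural
  number. Taking both \<open>d\<^sub>i - F\<close> and \<open>w\<^sub>i\<close> of size below
  \<open>1 / (k + 1)\<close> makes \<open>M\<close> dense. This index set also gives \<open>M\<close> a basis at
  least as large as the whole space, and \<open>M\<close> is a subspace, so the dimensions agree by
  the Schroeder-Bernstein theorem (\<open>same_hamel_dim_UNIV\<close>).

  It remains to find that many wild sequences. A null sequence of continuous functions is
  determined by comparing values at rational points with rational numbers, so the indices can be
  coded injectively by sets \<open>S\<close> of natural numbers (\<open>inj_code_set\<close>). The codes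
  of the finite prefixes of \<open>S\<close> form an infinite set, and two different sets share only
  finitely many prefixes. The function \<open>g\<^sub>S\<close> has a spike of height \<open>m\<close>
  at each prefix code \<open>m\<close> of \<open>S\<close>, so narrow that it is integrable. In a linear
  combination of such functions, far out on the prefix codes of one \<open>S\<close> only
  \<open>g\<^sub>S\<close> contributes, and its values there are unbounded. The wild sequence is
  \<open>c g\<^sub>S / (n + 1)\<close> with a small constant \<open>c\<close>
  (\<open>spike_combination_unbounded\<close>).
\<close>

section \<open>Families all of whose nontrivial combinations lie in a given set\<close>

text \<open>
  If \<open>v i = v j\<close> for distinct indices, or if the range were dependent, then some
  nontrivial combination would be zero, which is not in \<open>A\<close>.
\<close>

lemma nontrivial_combinations_span:
  fixes v :: "'i \<Rightarrow> 'a::real_vector"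
  assumes comb: "\<And>T a i. finite T \<Longrightarrow> i \<in> T \<Longrightarrow> a i \<noteq> 0 \<Longrightarrow> (\<Sum>j\<in>T. a j *\<^sub>R v j) \<in> A"
    and "0 \<notin> A"
  shows "inj v" "independent (range v)" "span (range v) - {0} \<subseteq> A"
proof -
  show inj: "inj v"
  proof (rule injI, rule ccontr)
    fix i j assume "v i = v j" "i \<noteq> j"
    \<comment> \<open>The combination \<open>v i - v j\<close> has nonzero coefficients but is zero.\<close>
    then have "(\<Sum>k\<in>{i, j}. (if k = i then 1 else - 1) *\<^sub>R v k) = 0" by simp
    with comb[of "{i, j}" i "\<lambda>k. if k = i then 1 else - 1"] \<open>0 \<notin> A\<close> show False by simp
  qed
  have reindex: "\<exists>T. finite T \<and> t = v ` T \<and> (\<Sum>x\<in>t. r x *\<^sub>R x) = (\<Sum>j\<in>T. r (v j) *\<^sub>R v j)"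
    if "finite t" "t \<subseteq> range v" for t r
  proof -
    obtain T where T: "t = v ` T" using \<open>t \<subseteq> range v\<close> by (auto simp: subset_image_iff)
    have "inj_on v T" using inj by (rule inj_on_subset) simp
    with T \<open>finite t\<close> show ?thesis
      by (intro exI[of _ T]) (auto simp: sum.reindex finite_image_iff)
  qed
  have span: "(\<Sum>x\<in>t. r x *\<^sub>R x) \<in> A"
    if t: "finite t" "t \<subseteq> range v" "x \<in> t" "r x \<noteq> 0" for t r x
  proof -
    obtain T where T: "finite T" "t = v ` T" "(\<Sum>x\<in>t. r x *\<^sub>R x) = (\<Sum>j\<in>T. r (v j) *\<^sub>R v j)"
      using reindex[OF t(1,2)] by blast
    with t obtain i where "i \<in> T" "x = v i" by auto
    with T t comb[of T i "r \<circ> v"] show ?thesis by simp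
  qed
  show "independent (range v)"
    unfolding dependent_explicit using span \<open>0 \<notin> A\<close> by metis
  show "span (range v) - {0} \<subseteq> A"
  proof
    fix y assume "y \<in> span (range v) - {0}"
    then obtain t r where t: "finite t" "t \<subseteq> range v" "y = (\<Sum>x\<in>t. r x *\<^sub>R x)" "y \<noteq> 0"
      by (auto simp: span_explicit)
    then obtain x where "x \<in> t" "r x \<noteq> 0"
      by (metis (mono_tags, lifting) scaleR_eq_0_iff sum.neutral)
    with span t show "y \<in> A" by blast
  qed
qed

text \<open>
  An independent set extends to a basis of the whole space, and that basis is no larger than the
  space itself, so that each of the two bases injects into the other.
\<close>

lemma same_hamel_dim_UNIV:
  fixes B :: "'a::real_vector set"
  assumes "independent B" "(UNIV :: 'a set) \<lesssim> B"
  shows "same_hamel_dim (span B) (UNIV :: 'a set)"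
proof -
  have "B \<lesssim> extend_basis B"
    by (intro subset_imp_lepoll extend_basis_superset assms)
  moreover have "extend_basis B \<lesssim> B"
    using subset_imp_lepoll[OF subset_UNIV] assms(2) by (rule lepoll_trans)
  ultimately show ?thesis
    unfolding same_hamel_dim_def
    using assms(1) independent_extend_basis[OF assms(1)] span_extend_basis[OF assms(1)]
      lepoll_antisym by blast
qed

section \<open>Convergence to zero in the function space\<close>

lemma cL1_fun_continuous: "continuous_on {0..} (cL1_fun f)"
  and cL1_fun_integrable: "set_integrable lebesgue {0..} (cL1_fun f)"
  and cL1_fun_negative: "x < 0 \<Longrightarrow> cL1_fun f x = 0"
  using cL1_fun[of f] by auto

lemma dist_cL1_size: "dist f g = cL1_size (\<lambda>x. cL1_fun f x - cL1_fun g x)"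
  by transfer simp

lemma dist_cL1_zero: "dist f 0 = cL1_size (cL1_fun f)"
  by transfer simp

lemma set_integrable_continuous_dominated:
  fixes u g :: "real \<Rightarrow> real"
  assumes "continuous_on {0..} u" "set_integrable lebesgue {0..} g"
    and "\<And>x. x \<ge> 0 \<Longrightarrow> \<bar>u x\<bar> \<le> \<bar>g x\<bar>"
  shows "set_integrable lebesgue {0..} u"
proof (rule set_integrable_bound[OF assms(2)])
  have "(\<lambda>x. indicator {0..} x *\<^sub>R u x) \<in> borel_measurable borel"
    using assms(1) by (intro borel_measurable_continuous_on_indicator) auto
  then show "set_borel_measurable lebesgue {0..} u"
    unfolding set_borel_measurable_def by (intro measurable_completion) simp
qed (use assms(3) in auto)

text \<open>
  Dominated convergence, applied to the integral and (as Tannery's theorem) to the weighted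
  series, whose terms are bounded by a geometric series. The lemma serves both for scaling a
  function down and for cutting it off farther and farther out.
\<close>

lemma cL1_size_tendsto_zero:
  fixes u :: "nat \<Rightarrow> real \<Rightarrow> real" and g :: "real \<Rightarrow> real"
  assumes cont: "\<And>k. continuous_on {0..} (u k)"
    and int: "set_integrable lebesgue {0..} g"
    and bound: "\<And>k x. x \<ge> 0 \<Longrightarrow> \<bar>u k x\<bar> \<le> \<bar>g x\<bar>"
    and sup: "\<And>n. (\<lambda>k. sup_norm_upto n (u k)) \<longlonglongrightarrow> 0"
  shows "(\<lambda>k. cL1_size (u k)) \<longlonglongrightarrow> 0"
proof -
  have int_u: "set_integrable lebesgue {0..} (u k)" for k
    by (rule set_integrable_continuous_dominated[OF cont int bound])
  have pointwise: "(\<lambda>k. u k x) \<longlonglongrightarrow> 0" if "x \<ge> 0" for x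
  proof (rule Lim_null_comparison[OF _ sup])
    show "\<forall>\<^sub>F k in sequentially. norm (u k x) \<le> sup_norm_upto (nat \<lceil>x\<rceil>) (u k)"
      using that by (auto intro!: always_eventually sup_norm_upto_upper cont)
  qed
  have "(\<lambda>k. LINT x|lebesgue. indicator {0..} x *\<^sub>R \<bar>u k x\<bar>) \<longlonglongrightarrow> (LINT x::real|lebesgue. (0::real))"
  proof (rule integral_dominated_convergence)
    show "integrable lebesgue (\<lambda>x. indicator {0..} x *\<^sub>R \<bar>g x\<bar>)"
      using set_integrable_abs[OF int] by (simp add: set_integrable_def)
    show "(\<lambda>x. indicator {0..} x *\<^sub>R \<bar>u k x\<bar>) \<in> borel_measurable lebesgue" for k
      using set_integrable_abs[OF int_u] by (simp add: set_integrable_def borel_measurable_integrable)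
    show "AE x in lebesgue. (\<lambda>k. indicator {0..} x *\<^sub>R \<bar>u k x\<bar>) \<longlonglongrightarrow> 0"
      using pointwise by (intro AE_I2) (auto simp: indicator_def tendsto_rabs_zero)
    show "AE x in lebesgue. norm (indicator {0..} x *\<^sub>R \<bar>u k x\<bar>) \<le> indicator {0..} x *\<^sub>R \<bar>g x\<bar>" for k
      using bound by (intro AE_I2) (auto simp: indicator_def)
  qed simp
  then have L1: "(\<lambda>k. L1_norm (u k)) \<longlonglongrightarrow> 0"
    by (simp add: L1_norm_def set_lebesgue_integral_def)
  let ?r = "\<lambda>n k. sup_norm_upto (Suc n) (u k) / (1 + sup_norm_upto (Suc n) (u k))"
  have "((\<lambda>k. \<Sum>n. 1 / 2 ^ Suc n * ?r n k) \<longlongrightarrow> (\<Sum>n. (0::real))) sequentially"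
  proof (rule tannerys_theorem[THEN conjunct2, THEN conjunct2])
    have "((\<lambda>k. 1 / 2 ^ Suc n * ?r n k) \<longlongrightarrow> 1 / 2 ^ Suc n * (0 / (1 + 0))) sequentially" for n
      by (intro tendsto_intros sup) simp
    then show "((\<lambda>k. 1 / 2 ^ Suc n * ?r n k) \<longlongrightarrow> 0) sequentially" for n by simp
    have "norm (1 / 2 ^ Suc n * ?r n k) \<le> (1 / 2) ^ n" for n k
    proof -
      have "0 \<le> ?r n k" "?r n k \<le> 1"
        using sup_norm_upto_nonneg[OF cont, of "Suc n" k] by (auto simp: divide_simps)
      moreover have "1 / 2 ^ Suc n \<le> (1 / 2 :: real) ^ n" by (simp add: power_divide divide_simps)
      ultimately have "1 / 2 ^ Suc n * ?r n k \<le> (1 / 2) ^ n * 1" by (intro mult_mono) auto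
      then show ?thesis
        using cL1_size_term_nonneg[OF cont, of n k] by (simp only: real_norm_def abs_of_nonneg mult_1_right)
    qed
    then show "\<forall>\<^sub>F (n, k) in at_top \<times>\<^sub>F sequentially. norm (1 / 2 ^ Suc n * ?r n k) \<le> (1 / 2) ^ n"
      by (intro always_eventually) auto
    show "summable (\<lambda>n. (1 / 2 :: real) ^ n)" by (rule summable_geometric) simp
  qed simp
  then have "(\<lambda>k. \<Sum>n. 1 / 2 ^ Suc n * ?r n k) \<longlonglongrightarrow> 0" by simp
  from tendsto_add[OF L1 this] show ?thesis by (simp add: cL1_size_def)
qed

lemma scaleR_tendsto_zero_cL1:
  "(\<lambda>k. dist (inverse (real (Suc k)) *\<^sub>R f) 0) \<longlonglongrightarrow> (0 :: real)" for f :: cL1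
proof -
  let ?c = "\<lambda>k. inverse (real (Suc k))"
  have "(\<lambda>k. cL1_size (\<lambda>x. ?c k * cL1_fun f x)) \<longlonglongrightarrow> 0"
  proof (rule cL1_size_tendsto_zero[OF _ cL1_fun_integrable])
    show "continuous_on {0..} (\<lambda>x. ?c k * cL1_fun f x)" for k
      by (intro continuous_intros cL1_fun_continuous)
    then have nonneg: "0 \<le> sup_norm_upto n (\<lambda>x. ?c k * cL1_fun f x)" for n k
      by (intro sup_norm_upto_nonneg)
    show "\<bar>?c k * cL1_fun f x\<bar> \<le> \<bar>cL1_fun f x\<bar>" for k x
      unfolding abs_mult by (rule mult_left_le_one_le) (auto simp: field_simps)
    show "(\<lambda>k. sup_norm_upto n (\<lambda>x. ?c k * cL1_fun f x)) \<longlonglongrightarrow> 0" for n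
    proof (rule Lim_null_comparison)
      show "\<forall>\<^sub>F k in sequentially. norm (sup_norm_upto n (\<lambda>x. ?c k * cL1_fun f x))
          \<le> ?c k * sup_norm_upto n (cL1_fun f)"
        using sup_norm_upto_mult[OF cL1_fun_continuous] nonneg
        by (intro always_eventually allI) (metis abs_inverse abs_of_nat abs_of_nonneg real_norm_def)
      show "(\<lambda>k. ?c k * sup_norm_upto n (cL1_fun f)) \<longlonglongrightarrow> 0"
        by (rule tendsto_mult_left_zero[OF LIMSEQ_inverse_real_of_nat])
    qed
  qed
  then show ?thesis by (simp add: dist_cL1_zero scaleR_cL1.rep_eq)
qed

section \<open>Density of the sequences of eventually vanishing functions\<close>

definition eventually_vanishing :: "cL1 set"
  where "eventually_vanishing = {f. \<forall>\<^sub>F x in at_top. cL1_fun f x = 0}"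

text \<open>
  Multiply by the continuous cut-off that is \<open>1\<close> up to \<open>k\<close> and \<open>0\<close>
  from \<open>k + 1\<close> on. The error is dominated by \<open>f\<close> and is zero on
  \<open>[0, n]\<close> once \<open>k \<ge> n\<close>.
\<close>

lemma eventually_vanishing_dense:
  assumes "e > 0"
  obtains g where "g \<in> eventually_vanishing" "dist g f < e"
proof -
  let ?cut = "\<lambda>k x. max 0 (min 1 (real k + 1 - x))"
  let ?u = "\<lambda>k x. ?cut k x * cL1_fun f x - cL1_fun f x"
  have cut: "continuous_on {0..} (\<lambda>x. ?cut k x * cL1_fun f x)" for k
    by (intro continuous_intros cL1_fun_continuous)
  have "(\<lambda>k. cL1_size (?u k)) \<longlonglongrightarrow> 0"
  proof (rule cL1_size_tendsto_zero[OF _ cL1_fun_integrable])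
    show "continuous_on {0..} (?u k)" for k
      by (intro continuous_on_diff cut cL1_fun_continuous)
    show "\<bar>?u k x\<bar> \<le> \<bar>cL1_fun f x\<bar>" for k x
    proof -
      have "?u k x = (?cut k x - 1) * cL1_fun f x" by (simp add: algebra_simps)
      moreover have "\<bar>?cut k x - 1\<bar> \<le> 1" by simp
      ultimately show ?thesis by (simp add: abs_mult mult_left_le_one_le)
    qed
    show "(\<lambda>k. sup_norm_upto n (?u k)) \<longlonglongrightarrow> 0" for n
    proof (rule tendsto_eventually)
      have "sup_norm_upto n (?u k) = 0" if "n \<le> k" for k
      proof -
        have "\<bar>?u k x\<bar> = 0" if "x \<in> {0..real n}" for x
          using that \<open>n \<le> k\<close> by (simp add: max_def min_def)
        then have "sup_norm_upto n (?u k) = (SUP x\<in>{0..real n}. 0)"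
          unfolding sup_norm_upto_def by (intro SUP_cong) auto
        then show ?thesis by simp
      qed
      then show "\<forall>\<^sub>F k in sequentially. sup_norm_upto n (?u k) = 0"
        by (auto simp: eventually_sequentially)
    qed
  qed
  then have "\<forall>\<^sub>F k in sequentially. cL1_size (?u k) < e"
    using \<open>e > 0\<close> by (rule order_tendstoD)
  then obtain k where k: "cL1_size (?u k) < e"
    by (auto simp: eventually_sequentially)
  define g where "g = Abs_cL1 (\<lambda>x. ?cut k x * cL1_fun f x)"
  have g: "cL1_fun g = (\<lambda>x. ?cut k x * cL1_fun f x)"
    unfolding g_def
  proof (rule Abs_cL1_inverse, intro CollectI conjI)
    show "set_integrable lebesgue {0..} (\<lambda>x. ?cut k x * cL1_fun f x)"
      by (rule set_integrable_continuous_dominated[OF cut cL1_fun_integrable[of f]])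
        (simp add: abs_mult mult_left_le_one_le)
  qed (use cut cL1_fun_negative in auto)
  show thesis
  proof
    have "cL1_fun g x = 0" if "real k + 1 \<le> x" for x
      using that by (simp add: g)
    then show "g \<in> eventually_vanishing"
      unfolding eventually_vanishing_def eventually_at_top_linorder by blast
    show "dist g f < e" using k by (simp add: dist_cL1_size g)
  qed
qed

lemma dist_c0_le:
  assumes "\<And>n. dist (c0_seq F n) (c0_seq G n) \<le> e"
  shows "dist F G \<le> e"
  unfolding dist_c0_cL1.rep_eq using assms by (intro cSUP_least) auto

lemma c0_seq_null: "(\<lambda>n. dist (c0_seq F n) 0) \<longlonglongrightarrow> 0"
  using c0_seq[of F] by simp

text \<open>
  The componentwise errors are chosen to tend to zero, so that the approximating sequence is again
  a null sequence.
\<close>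

lemma eventually_vanishing_sequences_dense:
  assumes "e > 0"
  obtains G where "\<And>n. c0_seq G n \<in> eventually_vanishing" "dist G F < e"
proof -
  let ?e = "\<lambda>n. e / 2 * inverse (real (Suc n))"
  have "\<exists>g. g \<in> eventually_vanishing \<and> dist g (c0_seq F n) < ?e n" for n
    using eventually_vanishing_dense[of "?e n"] \<open>e > 0\<close> by (metis half_gt_zero inverse_positive_iff_positive mult_pos_pos of_nat_0_less_iff zero_less_Suc)
  then obtain g where g: "\<And>n. g n \<in> eventually_vanishing" "\<And>n. dist (g n) (c0_seq F n) < ?e n"
    by metis
  have "(\<lambda>n. dist (g n) 0) \<longlonglongrightarrow> 0"
  proof (rule Lim_null_comparison)
    show "\<forall>\<^sub>F n in sequentially. norm (dist (g n) 0) \<le> ?e n + dist (c0_seq F n) 0"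
      using g(2) dist_triangle[of "g _" 0 "c0_seq F _"]
      by (intro always_eventually allI) (smt (verit) real_norm_def zero_le_dist)
    show "(\<lambda>n. ?e n + dist (c0_seq F n) 0) \<longlonglongrightarrow> 0"
      using tendsto_add[OF tendsto_mult_right_zero[OF LIMSEQ_inverse_real_of_nat, of "e / 2"] c0_seq_null]
      by simp
  qed
  then have G: "c0_seq (Abs_c0_cL1 g) = g" by (simp add: Abs_c0_cL1_inverse)
  have "?e n \<le> e / 2" for n
    using \<open>e > 0\<close> by (simp add: field_simps)
  then have "dist (Abs_c0_cL1 g) F \<le> e / 2"
    using g(2) by (intro dist_c0_le) (smt (verit) G)
  then show thesis
    using that[of "Abs_c0_cL1 g"] g(1) \<open>e > 0\<close> by (simp add: G)
qed

section \<open>Small sequences proportional to a single function\<close>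

definition harmonic_seq :: "cL1 \<Rightarrow> c0_cL1"
  where "harmonic_seq f = Abs_c0_cL1 (\<lambda>n. inverse (real (Suc n)) *\<^sub>R f)"

lemma c0_seq_harmonic_seq: "c0_seq (harmonic_seq f) n = inverse (real (Suc n)) *\<^sub>R f"
  unfolding harmonic_seq_def using scaleR_tendsto_zero_cL1[of f] by (simp add: Abs_c0_cL1_inverse)

lemma dist_harmonic_seq: "dist (harmonic_seq f) 0 \<le> dist f 0"
proof (rule dist_c0_le)
  fix n
  have "max 1 \<bar>inverse (real (Suc n))\<bar> = 1" by (simp add: field_simps)
  then show "dist (c0_seq (harmonic_seq f) n) (c0_seq 0 n) \<le> dist f 0"
    using dist_cL1_scaleR[of "inverse (real (Suc n))" f]
    by (simp add: c0_seq_harmonic_seq zero_c0_cL1.rep_eq)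
qed

text \<open>
  Rescaling \<open>f\<close> makes the whole sequence \<open>f / (n + 1)\<close> uniformly small,
  while the nonzero factor keeps unboundedness intact.
\<close>

lemma small_multiple:
  fixes f :: cL1
  assumes "e > 0"
  obtains c where "c \<noteq> 0" "dist (harmonic_seq (c *\<^sub>R f)) 0 < e"
proof -
  obtain k where "dist (inverse (real (Suc k)) *\<^sub>R f) 0 < e"
    using order_tendstoD(2)[OF scaleR_tendsto_zero_cL1 \<open>e > 0\<close>, of f]
    by (auto simp: eventually_sequentially)
  then show thesis
    using that[of "inverse (real (Suc k))"] dist_harmonic_seq le_less_trans by fastforce
qed

section \<open>Almost disjoint families of spikes\<close>

text \<open>
  A branch of the binary tree, recorded by its nodes: each code carries the length \<open>n\<close>
  of the prefix as well, so that every \<open>S\<close>, also a finite one, has infinitely many codes.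
\<close>

definition prefix_code :: "nat set \<Rightarrow> nat \<Rightarrow> nat"
  where "prefix_code S n = prod_encode (n, set_encode (S \<inter> {..<n}))"

lemma prefix_code_ge: "n \<le> prefix_code S n"
  by (simp add: prefix_code_def le_prod_encode_1)

lemma prefix_code_eq_iff: "prefix_code S m = prefix_code S' n \<longleftrightarrow> m = n \<and> S \<inter> {..<n} = S' \<inter> {..<n}"
  by (auto simp: prefix_code_def inj_prod_encode[THEN inj_eq] set_encode_eq)

text \<open>
  Prefixes that are longer than the first place where \<open>S\<close> and \<open>S'\<close> differ are
  different.
\<close>

lemma prefix_codes_almost_disjoint:
  assumes "S \<noteq> S'"
  shows "\<forall>\<^sub>F n in sequentially. prefix_code S n \<notin> range (prefix_code S')"
proof -
  obtain k where k: "k \<in> S \<longleftrightarrow> k \<notin> S'" using assms by blast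
  have "prefix_code S n \<notin> range (prefix_code S')" if "Suc k \<le> n" for n
    using that k by (auto simp: prefix_code_eq_iff set_eq_iff Suc_le_eq)
  then show ?thesis unfolding eventually_sequentially by blast
qed

text \<open>
  The width \<open>2 / 4 ^ j\<close> outweighs the height \<open>j\<close> that the tent is given below,
  so that the areas are summable.
\<close>

definition tent :: "nat \<Rightarrow> real \<Rightarrow> real"
  where "tent j x = max 0 (1 - 4 ^ j * \<bar>x - real j\<bar>)"

lemma tent_eq_0: "1 \<le> 4 ^ j * \<bar>x - real j\<bar> \<Longrightarrow> tent j x = 0"
  by (simp add: tent_def)

lemma tent_eq_0_far:
  assumes "1 \<le> \<bar>x - real j\<bar>"
  shows "tent j x = 0"
proof (rule tent_eq_0)
  have "1 * 1 \<le> 4 ^ j * \<bar>x - real j\<bar>" using assms by (intro mult_mono) auto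
  then show "1 \<le> 4 ^ j * \<bar>x - real j\<bar>" by simp
qed

lemma tent_nat: "tent j (real m) = (if j = m then 1 else 0)"
proof (cases "j = m")
  case False
  then have "1 \<le> \<bar>real m - real j\<bar>" by linarith
  with False show ?thesis by (simp add: tent_eq_0_far)
qed (simp add: tent_def)

definition spikes :: "nat set \<Rightarrow> real \<Rightarrow> real"
  where "spikes A x = (\<Sum>j. (if j \<in> A then real j else 0) * tent j x)"

lemma spikes_finite_sum:
  assumes "x \<le> real N"
  shows "spikes A x = (\<Sum>j\<le>N. (if j \<in> A then real j else 0) * tent j x)"
  unfolding spikes_def
proof (rule suminf_finite)
  fix j assume "j \<notin> {..N}"
  with assms have "1 \<le> \<bar>x - real j\<bar>" by simp
  then show "(if j \<in> A then real j else 0) * tent j x = 0" by (simp add: tent_eq_0_far)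
qed simp

lemma spikes_nat: "spikes A (real m) = (if m \<in> A then real m else 0)"
  proof -
  have "spikes A (real m) = (\<Sum>j\<le>m. (if j \<in> A then real j else 0) * tent j (real m))"
    by (rule spikes_finite_sum) simp
  also have "\<dots> = (\<Sum>j\<le>m. if j = m then (if j \<in> A then real j else 0) else 0)"
    by (intro sum.cong) (auto simp: tent_nat)
  finally show ?thesis by simp
qed

lemma spikes_negative:
  assumes "x < 0"
  shows "spikes A x = 0"
proof -
  have "spikes A x = (\<Sum>j\<le>0. (if j \<in> A then real j else 0) * tent j x)"
    using assms by (intro spikes_finite_sum) simp
  also have "\<dots> = 0" by (intro sum.neutral) auto
  finally show ?thesis .
qed

lemma continuous_on_spikes: "continuous_on UNIV (spikes A)"
proof -
  have "continuous_on {..<real N} (spikes A)" for N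
  proof -
    have "continuous_on {..<real N} (\<lambda>x. \<Sum>j\<le>N. (if j \<in> A then real j else 0) * tent j x)"
      unfolding tent_def by (intro continuous_intros)
    then show ?thesis
      by (rule continuous_on_eq) (intro spikes_finite_sum[symmetric], simp)
  qed
  then have "continuous_on (\<Union>N. {..<real N}) (spikes A)"
    by (intro continuous_on_open_UN) auto
  moreover have "(\<Union>N. {..<real N}) = UNIV"
    using reals_Archimedean2 by auto
  ultimately show ?thesis by simp
qed

text \<open>
  The spike at \<open>j\<close> has area at most \<open>j * 2 / 4 ^ j \<le> 2 / 2 ^ j\<close>.
\<close>

lemma integrable_spikes: "integrable lebesgue (spikes A)"
proof -
  let ?h = "\<lambda>j. if j \<in> A then real j else 0"
  let ?I = "\<lambda>j. {real j - (1 / 4) ^ j..real j + (1 / 4) ^ j}"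
  have tent_le: "tent j x \<le> indicator (?I j) x" for j x
  proof (cases "x \<in> ?I j")
    case False
    then have "(1 / 4) ^ j \<le> \<bar>x - real j\<bar>" by auto
    then have "4 ^ j * (1 / 4) ^ j \<le> 4 ^ j * \<bar>x - real j\<bar>" by (intro mult_left_mono) auto
    then have "1 \<le> 4 ^ j * \<bar>x - real j\<bar>" by (simp add: power_divide)
    with False show ?thesis by (simp add: tent_eq_0)
  qed (simp add: tent_def)
  have tent_nonneg: "0 \<le> tent j x" for j x by (simp add: tent_def)
  have ind: "integrable lebesgue (indicator (?I j) :: real \<Rightarrow> real)" for j
    by (intro integrable_real_indicator) (auto simp: emeasure_lborel_Icc_eq)
  have int_tent: "integrable lebesgue (tent j)" for j
  proof (rule Bochner_Integration.integrable_bound[OF ind])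
    have "tent j \<in> borel_measurable borel"
      unfolding tent_def by (intro borel_measurable_continuous_onI continuous_intros)
    then show "tent j \<in> borel_measurable lebesgue"
      by (intro measurable_completion) simp
  qed (use tent_le tent_nonneg in \<open>auto intro!: AE_I2\<close>)
  have le: "(LINT x|lebesgue. tent j x) \<le> 2 * (1 / 4) ^ j" for j
  proof -
    have "(LINT x|lebesgue. tent j x) \<le> (LINT x|lebesgue. indicator (?I j) x)"
      by (intro integral_mono int_tent ind tent_le)
    also have "\<dots> = 2 * (1 / 4) ^ j" by simp
    finally show ?thesis .
  qed
  show ?thesis
    unfolding spikes_def
  proof (rule integrable_suminf)
    show "integrable lebesgue (\<lambda>x. ?h j * tent j x)" for j
      by (intro integrable_mult_right int_tent)
    show "AE x in lebesgue. summable (\<lambda>j. norm (?h j * tent j x))"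
    proof (intro AE_I2)
      fix x :: real
      obtain N where N: "x \<le> real N" using real_arch_simple by blast
      show "summable (\<lambda>j. norm (?h j * tent j x))"
      proof (rule summable_finite[of "{..N}"])
        fix j assume "j \<notin> {..N}"
        with N have "1 \<le> \<bar>x - real j\<bar>" by simp
        then show "norm (?h j * tent j x) = 0" by (simp add: tent_eq_0_far)
      qed simp
    qed
    show "summable (\<lambda>j. LINT x|lebesgue. norm (?h j * tent j x))"
    proof (rule summable_comparison_test'[of "\<lambda>j. 2 * (1 / 2) ^ j" 0])
      show "summable (\<lambda>j. 2 * (1 / 2 :: real) ^ j)"
        by (intro summable_mult summable_geometric) simp
      fix j
      have j: "real j \<le> 2 ^ j" using of_nat_less_two_power[of j] by (simp add: less_imp_le)
      have "(LINT x|lebesgue. norm (?h j * tent j x)) = ?h j * (LINT x|lebesgue. tent j x)"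
        using tent_nonneg by (simp add: abs_mult)
      also have "\<dots> \<le> 2 ^ j * (2 * (1 / 4) ^ j)"
        using j tent_nonneg by (intro mult_mono le Bochner_Integration.integral_nonneg) auto
      also have "\<dots> = 2 * (2 * (1 / 4)) ^ j" by (simp only: power_mult_distrib mult.left_commute)
      also have "\<dots> = 2 * (1 / 2) ^ j" by simp
      finally show "norm (LINT x|lebesgue. norm (?h j * tent j x)) \<le> 2 * (1 / 2) ^ j"
        by simp
    qed
  qed
qed

lift_definition spikes_cL1 :: "nat set \<Rightarrow> cL1" is spikes
proof -
  fix A
  have "set_integrable lebesgue {0..} (spikes A)"
    unfolding set_integrable_def by (intro integrable_mult_indicator integrable_spikes) simp
  then show "continuous_on {0..} (spikes A) \<and> set_integrable lebesgue {0..} (spikes A) \<and> (\<forall>x<0. spikes A x = 0)"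
    using continuous_on_subset[OF continuous_on_spikes] by (auto simp: spikes_negative)
qed

section \<open>Combinations of spike sequences\<close>

lemma unbounded_cL1I:
  fixes x :: "nat \<Rightarrow> real"
  assumes "filterlim x at_top sequentially"
    and "filterlim (\<lambda>k. \<bar>cL1_fun f (x k)\<bar>) at_top sequentially"
  shows "f \<in> unbounded_cL1"
proof -
  have "(\<lambda>k. ereal \<bar>cL1_fun f (x k)\<bar>) \<longlonglongrightarrow> \<infinity>"
    using assms(2) by (simp add: tendsto_PInfty filterlim_at_top_dense)
  then have "\<infinity> = Limsup sequentially (\<lambda>k. ereal \<bar>cL1_fun f (x k)\<bar>)"
    by (simp add: lim_imp_Limsup)
  also have "\<dots> \<le> Limsup (filtermap x sequentially) (\<lambda>y. ereal \<bar>cL1_fun f y\<bar>)"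
    by (rule Limsup_filtermap_ge)
  also have "\<dots> \<le> Limsup at_top (\<lambda>y. ereal \<bar>cL1_fun f y\<bar>)"
    using assms(1) unfolding Limsup_def filterlim_def
    by (intro INF_superset_mono) (auto simp: le_filter_def)
  finally show ?thesis by (simp add: unbounded_cL1_def)
qed

lemma linear_cL1_fun: "linear (\<lambda>f. cL1_fun f x)"
  by (intro linearI) (simp_all add: plus_cL1.rep_eq scaleR_cL1.rep_eq)

lemma linear_c0_seq: "linear (\<lambda>F. c0_seq F n)"
  by (intro linearI) (simp_all add: plus_c0_cL1.rep_eq scaleR_c0_cL1.rep_eq)

text \<open>
  The combination is evaluated along the prefix codes of \<open>S i\<close>, where \<open>a i \<noteq> 0\<close>.
  Eventually all \<open>d j\<close> vanish there, and so do the spikes of the other finitely many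
  sets, by almost disjointness. What is left is a nonzero multiple of the code itself.
\<close>

lemma spike_combination_unbounded:
  fixes S :: "'i \<Rightarrow> nat set" and d :: "'i \<Rightarrow> c0_cL1" and a c :: "'i \<Rightarrow> real"
  assumes "inj S" and "\<And>j n. c0_seq (d j) n \<in> eventually_vanishing"
    and c: "\<And>j. c j \<noteq> 0"
    and T: "finite T" "i \<in> T" "a i \<noteq> 0"
  shows "(\<Sum>j\<in>T. a j *\<^sub>R (d j + harmonic_seq (c j *\<^sub>R spikes_cL1 (range (prefix_code (S j))))))
    \<in> null_seqs_unbounded"
proof -
  let ?A = "\<lambda>j. range (prefix_code (S j))"
  let ?F = "\<Sum>j\<in>T. a j *\<^sub>R (d j + harmonic_seq (c j *\<^sub>R spikes_cL1 (?A j)))"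
  let ?x = "prefix_code (S i)"
  have x: "filterlim (\<lambda>k. real (?x k)) at_top sequentially"
    by (rule filterlim_at_top_mono[OF filterlim_real_sequentially])
      (simp add: prefix_code_ge)
  have "c0_seq ?F n \<in> unbounded_cL1" for n
  proof (rule unbounded_cL1I[OF x])
    let ?b = "a i * (inverse (real (Suc n)) * c i)"
    have F: "cL1_fun (c0_seq ?F n) y = (\<Sum>j\<in>T. a j * (cL1_fun (c0_seq (d j) n) y
        + inverse (real (Suc n)) * (c j * spikes (?A j) y)))" for y
      by (simp add: linear_sum[OF linear_c0_seq] linear_sum[OF linear_cL1_fun]
          plus_cL1.rep_eq scaleR_cL1.rep_eq plus_c0_cL1.rep_eq scaleR_c0_cL1.rep_eq mult.assoc
          c0_seq_harmonic_seq spikes_cL1.rep_eq)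
    have "\<forall>\<^sub>F k in sequentially. \<forall>j\<in>T. cL1_fun (c0_seq (d j) n) (real (?x k)) = 0"
    proof (intro eventually_ball_finite T(1) ballI)
      fix j
      have "\<forall>\<^sub>F y in at_top. cL1_fun (c0_seq (d j) n) y = 0"
        using assms(2) by (simp add: eventually_vanishing_def)
      then show "\<forall>\<^sub>F k in sequentially. cL1_fun (c0_seq (d j) n) (real (?x k)) = 0"
        using x by (rule eventually_compose_filterlim)
    qed
    moreover have "\<forall>\<^sub>F k in sequentially. \<forall>j\<in>T - {i}. ?x k \<notin> ?A j"
      using \<open>inj S\<close> T(1)
      by (intro eventually_ball_finite ballI prefix_codes_almost_disjoint) (auto dest: injD)
    ultimately have "\<forall>\<^sub>F k in sequentially. \<bar>?b\<bar> * real (?x k) \<le> \<bar>cL1_fun (c0_seq ?F n) (real (?x k))\<bar>"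
    proof eventually_elim
      case (elim k)
      have "cL1_fun (c0_seq ?F n) (real (?x k))
          = (\<Sum>j\<in>T. if j = i then ?b * real (?x k) else 0)"
        unfolding F using elim by (intro sum.cong) (auto simp: spikes_nat)
      also have "\<dots> = ?b * real (?x k)" using T by simp
      finally show ?case by (simp add: abs_mult)
    qed
    moreover have "filterlim (\<lambda>k. \<bar>?b\<bar> * real (?x k)) at_top sequentially"
      using c T by (intro filterlim_tendsto_pos_mult_at_top[OF tendsto_const _ x]) simp
    ultimately show "filterlim (\<lambda>k. \<bar>cL1_fun (c0_seq ?F n) (real (?x k))\<bar>) at_top sequentially"
      by (rule filterlim_at_top_mono[rotated])
  qed
  then show ?thesis by (simp add: null_seqs_unbounded_def c0_seq_null)
qed

section \<open>Coding null sequences by sets of natural numbers\<close>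

definition rational_cuts :: "c0_cL1 \<Rightarrow> (nat \<times> rat \<times> rat) set"
  where "rational_cuts F = {(n, q, r). cL1_fun (c0_seq F n) (of_rat q) < of_rat r}"

text \<open>
  The cuts determine the values at rational points, and by continuity those determine the
  function on the half-line.
\<close>

lemma inj_rational_cuts: "inj rational_cuts"
proof (rule injI)
  fix F G assume eq: "rational_cuts F = rational_cuts G"
  have rat: "cL1_fun (c0_seq F n) (of_rat q) = cL1_fun (c0_seq G n) (of_rat q)" for n q
  proof -
    have cut: "cL1_fun (c0_seq F n) (of_rat q) < of_rat r \<longleftrightarrow> cL1_fun (c0_seq G n) (of_rat q) < of_rat r" for r
      using eq by (auto simp: rational_cuts_def set_eq_iff)
    show ?thesis
      using cut of_rat_dense by (metis less_asym linorder_neqE_linordered_idom)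
  qed
  have "cL1_fun (c0_seq F n) x = cL1_fun (c0_seq G n) x" for n x
  proof (cases "x \<ge> 0")
    case True
    let ?Q = "\<rat> \<inter> {0<..} :: real set"
    have "?Q \<subseteq> {0..}" by auto
    then have "closure ?Q \<subseteq> {0..}" by (rule closure_minimal) simp
    then have cont: "continuous_on (closure ?Q) (\<lambda>x. cL1_fun (c0_seq F n) x - cL1_fun (c0_seq G n) x)"
      by (intro continuous_on_diff continuous_on_subset[OF cL1_fun_continuous])
    have "x \<in> closure ?Q"
      unfolding closure_approachable
    proof (intro allI impI)
      fix e :: real assume "e > 0"
      then obtain y where "y \<in> \<rat>" "x < y" "y < x + e"
        using Rats_dense_in_real[of x "x + e"] by auto
      with True show "\<exists>y\<in>?Q. dist y x < e"
        by (intro bexI[of _ y]) (auto simp: dist_real_def)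
    qed
    moreover have "cL1_fun (c0_seq F n) y - cL1_fun (c0_seq G n) y = 0" if "y \<in> ?Q" for y
      using that rat by (auto elim!: Rats_cases)
    ultimately have "cL1_fun (c0_seq F n) x - cL1_fun (c0_seq G n) x = 0"
      using continuous_constant_on_closure[OF cont] by blast
    then show ?thesis by simp
  qed (simp add: cL1_fun_negative)
  then have "c0_seq F n = c0_seq G n" for n
    by (simp add: cL1_fun_inject[symmetric] fun_eq_iff)
  then show "F = G" by (simp add: c0_seq_inject[symmetric] fun_eq_iff)
qed

lemma rational_cuts_nonempty: "rational_cuts F \<noteq> {}"
proof -
  obtain r where "cL1_fun (c0_seq F 0) 0 < of_rat r"
    using of_rat_dense[of "cL1_fun (c0_seq F 0) 0" "cL1_fun (c0_seq F 0) 0 + 1"] by auto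
  then have "(0, 0, r) \<in> rational_cuts F" by (simp add: rational_cuts_def)
  then show ?thesis by blast
qed

text \<open>
  The product with the singleton records the second component of the index; it can be read off
  again because no set of rational cuts is empty.
\<close>

definition code_set :: "c0_cL1 \<times> nat \<Rightarrow> nat set"
  where "code_set i = to_nat ` ({snd i} \<times> rational_cuts (fst i))"

lemma inj_code_set: "inj code_set"
proof (rule injI)
  fix i j assume "code_set i = code_set j"
  then have "{snd i} \<times> rational_cuts (fst i) = {snd j} \<times> rational_cuts (fst j)"
    unfolding code_set_def by (simp only: inj_image_eq_iff[OF inj_to_nat])
  then have "snd i = snd j" "rational_cuts (fst i) = rational_cuts (fst j)"
    using rational_cuts_nonempty by (auto simp: times_eq_iff)
  then show "i = j"
    using inj_rational_cuts by (simp add: prod_eq_iff inj_eq)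
qed

section \<open>A dense subspace of maximal dimension\<close>

lemma zero_not_null_seqs_unbounded: "0 \<notin> null_seqs_unbounded"
proof -
  have "Limsup at_top (\<lambda>x::real. ereal 0) = 0"
    by (simp add: Limsup_const zero_ereal_def)
  then show ?thesis
    by (simp add: null_seqs_unbounded_def unbounded_cL1_def zero_c0_cL1.rep_eq zero_cL1.rep_eq zero_ereal_def)
qed

theorem theorem3p2:
  shows "maximal_dense_lineable null_seqs_unbounded"
proof -
  let ?e = "\<lambda>i :: c0_cL1 \<times> nat. inverse (real (Suc (snd i)))"
  let ?w = "\<lambda>c i. harmonic_seq (c *\<^sub>R spikes_cL1 (range (prefix_code (code_set i))))"
  have "\<exists>G. (\<forall>n. c0_seq G n \<in> eventually_vanishing) \<and> dist G (fst i) < ?e i" for i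
    using eventually_vanishing_sequences_dense[of "?e i" "fst i"] by auto
  then obtain d where d: "\<And>i n. c0_seq (d i) n \<in> eventually_vanishing"
    "\<And>i. dist (d i) (fst i) < ?e i" by metis
  have "\<exists>c. c \<noteq> 0 \<and> dist (?w c i) 0 < ?e i" for i
    by (rule small_multiple[of "?e i"]) auto
  then obtain c where c: "\<And>i. c i \<noteq> 0" "\<And>i. dist (?w (c i) i) 0 < ?e i" by metis
  define v where "v i = d i + ?w (c i) i" for i
  have comb: "(\<Sum>j\<in>T. a j *\<^sub>R v j) \<in> null_seqs_unbounded"
    if "finite T" "i \<in> T" "a i \<noteq> 0" for T a i
    unfolding v_def using inj_code_set d(1) c(1) that by (rule spike_combination_unbounded)
  note v = nontrivial_combinations_span[of v, OF comb zero_not_null_seqs_unbounded]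
  have dist_v: "dist (v i) (fst i) < 2 * ?e i" for i
  proof -
    have "dist (v i) (d i) = dist (?w (c i) i) 0"
      unfolding v_def dist_c0_cL1.rep_eq dist_cL1_size
      by (simp add: plus_c0_cL1.rep_eq zero_c0_cL1.rep_eq plus_cL1.rep_eq zero_cL1.rep_eq)
    with c(2) have "dist (v i) (d i) < ?e i" by (simp only:)
    with d(2) have "dist (v i) (d i) + dist (d i) (fst i) < ?e i + ?e i"
      by (intro add_strict_mono)
    with dist_triangle show ?thesis
      unfolding mult_2 by (rule le_less_trans)
  qed
  have "closure (span (range v)) = UNIV"
  proof (intro UNIV_eq_I[symmetric], unfold closure_approachable, intro allI impI)
    fix F :: c0_cL1 and e :: real assume "e > 0"
    then obtain k where "inverse (real (Suc k)) < e / 2"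
      using reals_Archimedean[of "e / 2"] by auto
    then have "dist (v (F, k)) F < e" using dist_v[of "(F, k)"] by simp
    then show "\<exists>y\<in>span (range v). dist y F < e" by (blast intro: span_base)
  qed
  moreover have "(UNIV :: c0_cL1 set) \<lesssim> range v"
    unfolding lepoll_def
    using v(1) by (intro exI[of _ "\<lambda>F. v (F, 0)"]) (auto simp: inj_def)
  ultimately show ?thesis
    unfolding maximal_dense_lineable_def
    by (intro exI[of _ "span (range v)"] conjI subspace_span v(3) same_hamel_dim_UNIV v(2))
qed

end
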